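(* Let $k$ be a positive integer and let $D$ be an $m$-colored digraph that is a locally out-tournament digraph (respectively, a locally in-tournament digraph) such that (i) every arc of $D$ belongs to a directed cycle of $D$, and (ii) every directed cycle of $D$ is at most $k$-colored. Then $D$ has a $k$-colored kernel.
   Context: Digraphs are finite, nonempty, without loops or parallel arcs (pairs of opposite arcs are allowed in general, and such a pair forms a directed cycle of length 2); $V(D)$ and $A(D)$ denote the vertex and arc sets of $D$. A tournament is an orientation of a complete graph. A digraph $D$ is a locally in-tournament digraph (resp. locally out-tournament digraph) if for every $u\in V(D)$ the set $N^-(u)$ of in-neighbors of $u$ (resp. the set $N^+(u)$ of out-neighbors of $u$) induces a tournament. A digraph $D$ is $m$-colored ($m$ a positive integer) if its arcs are colored with $m$ colors (each arc receives one color; no properness condition). A directed cycle is at most $k$-colored if its arcs use at most $k$ colors. Directed paths have no repeated vertices. For a positive integer $j$, a directed path is $j$-colored if its arcs use exactly $j$ colors; $u\leadsto_j v$ denotes a $j$-colored directed path from $u$ to $v$. A nonempty set $K\subseteq V(D)$ is a $k$-colored kernel of $D$ if it is both: (a) $k$-colored absorbent: for every $u\in V(D)\setminus K$ there exist $v\in K$ and $1\leq j\leq k$ with a path $u\leadsto_j v$ in $D$; and (b) $k$-colored independent: for all distinct $u,v\in K$ there is no path $u\leadsto_j v$ with $1\leq j\leq k$. *)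

theory Defs
  imports "Graph_Theory.Graph_Theory"
begin

text \<open>
  The locale \<open>digraph\<close> provides finite digraphs without loops and without parallel arcs;
  opposite arcs are allowed, and they form a directed cycle of length 2 in the sense of
  \<open>pre_digraph.cycle\<close>. Nonemptiness of the vertex set is not part of the locale.
\<close>

text \<open>
  The digraph without vertices counts as a tournament, so that a vertex without in-neighbors
  (out-neighbors) does not violate the local tournament conditions below.
\<close>

definition tournament :: "('a, 'b) pre_digraph \<Rightarrow> bool" where
  "tournament T \<longleftrightarrow> digraph T \<and>
     (\<forall>u \<in> verts T. \<forall>v \<in> verts T. u \<noteq> v \<longrightarrow>
        (u \<rightarrow>\<^bsub>T\<^esub> v \<or> v \<rightarrow>\<^bsub>T\<^esub> u) \<and> \<not> (u \<rightarrow>\<^bsub>T\<^esub> v \<and> v \<rightarrow>\<^bsub>T\<^esub> u))"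

definition in_neighbors :: "('a, 'b) pre_digraph \<Rightarrow> 'a \<Rightarrow> 'a set" where
  "in_neighbors G u = {v. v \<rightarrow>\<^bsub>G\<^esub> u}"

definition out_neighbors :: "('a, 'b) pre_digraph \<Rightarrow> 'a \<Rightarrow> 'a set" where
  "out_neighbors G u = {v. u \<rightarrow>\<^bsub>G\<^esub> v}"

definition locally_in_tournament :: "('a, 'b) pre_digraph \<Rightarrow> bool" where
  "locally_in_tournament G \<longleftrightarrow>
     digraph G \<and> (\<forall>u \<in> verts G. tournament (G \<restriction> in_neighbors G u))"

definition locally_out_tournament :: "('a, 'b) pre_digraph \<Rightarrow> bool" where
  "locally_out_tournament G \<longleftrightarrow>
     digraph G \<and> (\<forall>u \<in> verts G. tournament (G \<restriction> out_neighbors G u))"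

definition m_colored :: "nat \<Rightarrow> ('a, 'b) pre_digraph \<Rightarrow> ('b \<Rightarrow> nat) \<Rightarrow> bool" where
  "m_colored m G c \<longleftrightarrow> c ` arcs G \<subseteq> {1..m}"

definition num_colors :: "('b \<Rightarrow> nat) \<Rightarrow> 'b list \<Rightarrow> nat" where
  "num_colors c p = card (c ` set p)"

definition colored_path ::
  "('a, 'b) pre_digraph \<Rightarrow> ('b \<Rightarrow> nat) \<Rightarrow> nat \<Rightarrow> 'a \<Rightarrow> 'b list \<Rightarrow> 'a \<Rightarrow> bool" where
  "colored_path G c j u p v \<longleftrightarrow> pre_digraph.apath G u p v \<and> num_colors c p = j"

definition colored_absorbent ::
  "('a, 'b) pre_digraph \<Rightarrow> ('b \<Rightarrow> nat) \<Rightarrow> nat \<Rightarrow> 'a set \<Rightarrow> bool" where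
  "colored_absorbent G c k K \<longleftrightarrow>
     (\<forall>u \<in> verts G - K. \<exists>v \<in> K. \<exists>j \<in> {1..k}. \<exists>p. colored_path G c j u p v)"

definition colored_independent ::
  "('a, 'b) pre_digraph \<Rightarrow> ('b \<Rightarrow> nat) \<Rightarrow> nat \<Rightarrow> 'a set \<Rightarrow> bool" where
  "colored_independent G c k K \<longleftrightarrow>
     (\<forall>u \<in> K. \<forall>v \<in> K. u \<noteq> v \<longrightarrow> \<not> (\<exists>j \<in> {1..k}. \<exists>p. colored_path G c j u p v))"

definition colored_kernel ::
  "('a, 'b) pre_digraph \<Rightarrow> ('b \<Rightarrow> nat) \<Rightarrow> nat \<Rightarrow> 'a set \<Rightarrow> bool" where
  "colored_kernel G c k K \<longleftrightarrow>
     K \<noteq> {} \<and> K \<subseteq> verts G \<and> colored_absorbent G c k K \<and> colored_independent G c k K"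

end

theory Submission
  imports Defs
begin

text \<open>
  Since every arc lies on a directed cycle, reachability is symmetric, so no arc joins two
  strong components. A strong component with more than one vertex has a Hamiltonian cycle: this is
  the theorem of Bang-Jensen, Huang and Prisner on strong locally in-semicomplete digraphs
  (\<open>hamiltonian_cycle_if_locally_in_semicomplete\<close>), and the out-version is its
  dual. A Hamiltonian cycle has at most \<open>k\<close> colors, so its segments provide, between any two
  vertices of the component, a path with at most \<open>k\<close> colors. Hence any set with exactly one vertex
  from each strong component is a \<open>k\<close>-colored kernel: it is absorbent inside each component, and
  independent because there are no paths at all between distinct components.

  For Hamiltonicity, take a longest cycle \<open>C\<close> and suppose that it misses a vertex. Some outside
  vertex \<open>a\<close> has an arc to a vertex of \<open>C\<close>. Then \<open>a\<close> is adjacent to the predecessor of this vertex on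
  \<open>C\<close>, and if the arc went from the predecessor to \<open>a\<close>, then \<open>a\<close> could be inserted into \<open>C\<close>. So \<open>a\<close>
  dominates the predecessor too and, going round, all of \<open>C\<close>. But \<open>a\<close> is reachable
  from \<open>C\<close> by a path that leaves \<open>C\<close> at some \<open>x\<close> and then avoids \<open>C\<close>; inserting this path between
  \<open>x\<close> and its successor, which \<open>a\<close> dominates, gives a longer cycle.
\<close>

section \<open>Cycles of a binary relation\<close>

definition vertex_cycle :: "('a \<Rightarrow> 'a \<Rightarrow> bool) \<Rightarrow> 'a list \<Rightarrow> bool" where
  "vertex_cycle R xs \<longleftrightarrow>
     xs \<noteq> [] \<and> distinct xs \<and> successively R xs \<and> R (last xs) (hd xs)"

lemma vertex_cycle_rotate: "vertex_cycle R (xs @ ys) \<Longrightarrow> vertex_cycle R (ys @ xs)"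
  by (cases "xs = []"; cases "ys = []")
     (auto simp: vertex_cycle_def successively_append_iff)

lemma vertex_cycle_rev: "vertex_cycle R\<inverse>\<inverse> xs \<Longrightarrow> vertex_cycle R (rev xs)"
  by (auto simp: vertex_cycle_def hd_rev last_rev conversep_iff[abs_def])

lemma vertex_cycle_start_at:
  assumes "vertex_cycle R xs" "x \<in> set xs"
  obtains ys where "vertex_cycle R (x # ys)" "set (x # ys) = set xs" "length (x # ys) = length xs"
proof -
  obtain as bs where "xs = as @ x # bs"
    using split_list[OF assms(2)] by blast
  with assms(1) vertex_cycle_rotate[of R as "x # bs"] show thesis
    by (intro that[of "bs @ as"]) auto
qed

lemma vertex_cycle_end_at:
  assumes "vertex_cycle R xs" "x \<in> set xs"
  obtains ys where "vertex_cycle R (ys @ [x])" "set (ys @ [x]) = set xs"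
    "length (ys @ [x]) = length xs"
proof -
  obtain as bs where "xs = as @ x # bs"
    using split_list[OF assms(2)] by blast
  with assms(1) vertex_cycle_rotate[of R "as @ [x]" bs] show thesis
    by (intro that[of "bs @ as"]) auto
qed

lemma successively_imp_rtranclp:
  "successively R (x # xs) \<Longrightarrow> y \<in> set (x # xs) \<Longrightarrow> R\<^sup>*\<^sup>* x y"
proof (induction xs arbitrary: x)
  case (Cons z zs)
  then show ?case
    by (auto intro: converse_rtranclp_into_rtranclp)
qed simp

lemma vertex_cycle_imp_rtranclp:
  assumes "vertex_cycle R xs" "x \<in> set xs" "y \<in> set xs"
  shows "R\<^sup>*\<^sup>* x y"
proof -
  obtain ys where "vertex_cycle R (x # ys)" "set (x # ys) = set xs"
    using vertex_cycle_start_at[OF assms(1,2)] .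
  with assms(3) show ?thesis
    using successively_imp_rtranclp[of R x ys y] by (auto simp: vertex_cycle_def)
qed

text \<open>
  A walk from \<open>S\<close> to a vertex outside \<open>S\<close>, cut after its last visit to \<open>S\<close> and freed of
  repetitions, is the part outside \<open>S\<close> of an ear of \<open>S\<close>.
\<close>

lemma exit_path:
  assumes "R\<^sup>*\<^sup>* x y" "x \<in> S" "y \<notin> S"
  shows "\<exists>ws s. ws \<noteq> [] \<and> distinct ws \<and> set ws \<inter> S = {} \<and> successively R ws \<and>
           last ws = y \<and> s \<in> S \<and> R s (hd ws)"
  using assms
proof (induction rule: rtranclp_induct)
  case base
  then show ?case by simp
next
  case (step y z)
  show ?case
  proof (cases "y \<in> S")
    case True
    with step show ?thesis by (intro exI[of _ "[z]"] exI[of _ y]) auto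
  next
    case False
    with step obtain ws s where ws: "ws \<noteq> []" "distinct ws" "set ws \<inter> S = {}"
      "successively R ws" "last ws = y" "s \<in> S" "R s (hd ws)"
      by blast
    show ?thesis
    proof (cases "z \<in> set ws")
      case True
      then obtain as bs where "ws = (as @ [z]) @ bs"
        using split_list[of z ws] by auto
      with ws have "distinct (as @ [z])" "set (as @ [z]) \<inter> S = {}" "successively R (as @ [z])"
        "R s (hd (as @ [z]))"
        by (auto simp: successively_append_iff hd_append)
      with ws show ?thesis
        by (intro exI[of _ "as @ [z]"] exI[of _ s]) auto
    next
      case False
      with ws step show ?thesis
        by (intro exI[of _ "ws @ [z]"] exI[of _ s]) (auto simp: successively_append_iff)
    qed
  qed
qed

lemma rtranclp_enters:
  assumes "R\<^sup>*\<^sup>* x y" "x \<notin> S" "y \<in> S"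
  obtains a b where "R a b" "a \<notin> S" "b \<in> S"
proof -
  have "R\<^sup>*\<^sup>* x y \<Longrightarrow> y \<in> S \<Longrightarrow> \<exists>a b. R a b \<and> a \<notin> S \<and> b \<in> S"
    by (induction rule: rtranclp_induct) (use assms(2) in auto)
  with assms that show thesis by blast
qed

section \<open>Hamiltonian cycles in locally semicomplete components\<close>

text \<open>
  If \<open>a\<close> had an arc to some but not all vertices of the cycle, then two consecutive vertices
  would witness this; local semicompleteness at the second one gives an arc from the first one
  to \<open>a\<close>, and \<open>a\<close> fits between the two.
\<close>

lemma dominates_cycle_if_not_insertable:
  assumes cyc: "vertex_cycle R xs"
    and in_local: "\<And>a b x. R a x \<Longrightarrow> R b x \<Longrightarrow> a \<noteq> b \<Longrightarrow> R a b \<or> R b a"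
    and a: "a \<notin> set xs" "R a b" "b \<in> set xs"
    and longest: "\<And>zs. vertex_cycle R zs \<Longrightarrow> b \<in> set zs \<Longrightarrow> length zs \<le> length xs"
    and y: "y \<in> set xs"
  shows "R a y"
proof (rule ccontr)
  assume not_y: "\<not> R a y"
  obtain ys where ys: "vertex_cycle R (b # ys)" "set (b # ys) = set xs"
      "length (b # ys) = length xs"
    using vertex_cycle_start_at[OF cyc a(3)] .
  from not_y y a(2) ys(2) have "\<exists>p\<in>set ys. \<not> R a p"
    by auto
  \<comment> \<open>Going round from \<open>b\<close>, the last vertex \<open>p\<close> without arc from \<open>a\<close> has a successor that \<open>a\<close>
      dominates; this successor is \<open>b\<close> itself if \<open>vs\<close> is empty.\<close>
  then obtain us p vs where split: "ys = us @ p # vs" "\<not> R a p" "\<forall>v\<in>set vs. R a v"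
    using split_list_last_prop[of ys "\<lambda>p. \<not> R a p"] by auto
  define zs where "zs = vs @ b # us @ [p]"
  have zs: "vertex_cycle R zs"
    using ys(1) split(1) vertex_cycle_rotate[of R "b # us @ [p]" vs] by (simp add: zs_def)
  have set_zs: "set zs = set xs"
    using ys(2) split(1) by (auto simp: zs_def)
  have p: "last zs = p"
    by (simp add: zs_def)
  have "hd zs = b \<or> hd zs \<in> set vs"
    by (cases vs) (auto simp: zs_def)
  with a(2) split(3) have a_hd: "R a (hd zs)"
    by auto
  have "p \<noteq> a"
    using a(1) set_zs by (auto simp: zs_def)
  with in_local[of p "hd zs" a] zs a_hd split(2) p have "R p a"
    by (auto simp: vertex_cycle_def)
  with zs a_hd a(1) set_zs p have "vertex_cycle R (a # zs)"
    by (auto simp: vertex_cycle_def successively_Cons)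
  with longest[of "a # zs"] a(3) set_zs have "length (a # zs) \<le> length xs"
    by auto
  moreover have "length zs = length xs"
    using ys(3) split(1) by (simp add: zs_def)
  ultimately show False by simp
qed

text \<open>
  The component is given as the set of vertices reachable from a vertex \<open>u\<close>, and \<open>sym\<close> makes this
  set strongly connected; the successor \<open>w\<close> of \<open>u\<close> ensures that the component contains a cycle
  at all.
\<close>

lemma hamiltonian_cycle_if_locally_in_semicomplete:
  fixes R :: "'a \<Rightarrow> 'a \<Rightarrow> bool"
  assumes fin: "finite {v. R\<^sup>*\<^sup>* u v}"
    and in_local: "\<And>a b x. R a x \<Longrightarrow> R b x \<Longrightarrow> a \<noteq> b \<Longrightarrow> R a b \<or> R b a"
    and sym: "\<And>a b. R a b \<Longrightarrow> R\<^sup>*\<^sup>* b a"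
    and "R u w"
  shows "\<exists>xs. vertex_cycle R xs \<and> set xs = {v. R\<^sup>*\<^sup>* u v}"
proof -
  define C where "C = {v. R\<^sup>*\<^sup>* u v}"
  have rsym: "R\<^sup>*\<^sup>* b a" if "R\<^sup>*\<^sup>* a b" for a b
    using that by (induction rule: rtranclp_induct) (auto dest: sym)
  have connected: "R\<^sup>*\<^sup>* a b" if "a \<in> C" "b \<in> C" for a b
    using that rsym unfolding C_def by (blast intro: rtranclp_trans)
  have cycle_in_C: "set zs \<subseteq> C" if "vertex_cycle R zs" "x \<in> set zs" "x \<in> C" for zs x
    using vertex_cycle_imp_rtranclp[OF that(1,2)] that(3)
    unfolding C_def by (auto intro: rtranclp_trans)
  define P where "P zs \<longleftrightarrow> vertex_cycle R zs \<and> set zs \<subseteq> C" for zs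
  have "\<exists>zs. P zs"
  proof (cases "u = w")
    case True
    with \<open>R u w\<close> show ?thesis
      by (intro exI[of _ "[u]"]) (auto simp: P_def C_def vertex_cycle_def)
  next
    case False
    then obtain ws where ws: "ws \<noteq> []" "distinct ws" "w \<notin> set ws" "successively R ws"
      "last ws = u" "R w (hd ws)"
      using exit_path[OF sym[OF \<open>R u w\<close>], of "{w}"] by auto
    with \<open>R u w\<close> have "vertex_cycle R (w # ws)"
      by (auto simp: vertex_cycle_def successively_Cons)
    moreover have "w \<in> C"
      using \<open>R u w\<close> by (auto simp: C_def)
    ultimately show ?thesis
      using cycle_in_C[of "w # ws" w] by (intro exI[of _ "w # ws"]) (auto simp: P_def)
  qed
  moreover have "length zs \<le> card C" if "P zs" for zs
    using that fin distinct_card[of zs] card_mono[of C "set zs"]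
    by (auto simp: P_def vertex_cycle_def C_def)
  ultimately obtain xs where xs: "P xs" and longest: "\<And>zs. P zs \<Longrightarrow> length zs \<le> length xs"
    using ex_has_greatest_nat[of P _ length "Suc (card C)"] by (meson less_Suc_eq_le)
  have cyc: "vertex_cycle R xs" and sub: "set xs \<subseteq> C"
    using xs by (auto simp: P_def)
  have "set xs = C"
  proof (rule ccontr)
    assume "set xs \<noteq> C"
    with sub obtain v where v: "v \<in> C" "v \<notin> set xs" by blast
    have hd_in: "hd xs \<in> set xs"
      using cyc by (simp add: vertex_cycle_def)
    with sub v(1) have "R\<^sup>*\<^sup>* v (hd xs)"
      by (auto intro: connected)
    then obtain a b where ab: "R a b" "a \<notin> set xs" "b \<in> set xs"
      using rtranclp_enters v(2) hd_in by metis
    have "b \<in> C"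
      using ab(3) sub by blast
    have dominates: "R a y" if "y \<in> set xs" for y
    proof (rule dominates_cycle_if_not_insertable[OF cyc in_local ab(2,1,3) _ that])
      show "length zs \<le> length xs" if "vertex_cycle R zs" "b \<in> set zs" for zs
        using cycle_in_C[OF that \<open>b \<in> C\<close>] that(1) by (intro longest) (auto simp: P_def)
    qed
    have "R\<^sup>*\<^sup>* b a"
      using sym[OF ab(1)] .
    from exit_path[OF this ab(3,2)]
    obtain ws s where ws: "ws \<noteq> []" "distinct ws" "set ws \<inter> set xs = {}" "successively R ws"
      "last ws = a" "s \<in> set xs" "R s (hd ws)"
      by blast
    obtain ys where ys: "vertex_cycle R (ys @ [s])" "set (ys @ [s]) = set xs"
        "length (ys @ [s]) = length xs"
      using vertex_cycle_end_at[OF cyc ws(6)] .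
    have "hd ((ys @ [s]) @ ws) \<in> set xs"
      using ys(2) by (cases ys) auto
    then have "R a (hd ((ys @ [s]) @ ws))"
      by (rule dominates)
    with ws ys(1,2) have longer: "vertex_cycle R ((ys @ [s]) @ ws)"
      unfolding vertex_cycle_def by (subst successively_append_iff) auto
    have "set ((ys @ [s]) @ ws) \<subseteq> C"
      using longer ws(6) sub by (intro cycle_in_C[of _ s]) auto
    with longest[of "(ys @ [s]) @ ws"] longer ys(3) ws(1) show False
      by (cases ws) (auto simp: P_def)
  qed
  with cyc show ?thesis
    by (auto simp: C_def)
qed

text \<open>
  Reversing all arcs turns the out-condition into the in-condition; as reachability is
  symmetric, the component of \<open>u\<close> stays the same.
\<close>

lemma hamiltonian_cycle_if_locally_out_semicomplete:
  fixes R :: "'a \<Rightarrow> 'a \<Rightarrow> bool"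
  assumes fin: "finite {v. R\<^sup>*\<^sup>* u v}"
    and out_local: "\<And>a b x. R x a \<Longrightarrow> R x b \<Longrightarrow> a \<noteq> b \<Longrightarrow> R a b \<or> R b a"
    and sym: "\<And>a b. R a b \<Longrightarrow> R\<^sup>*\<^sup>* b a"
    and "R u w"
  shows "\<exists>xs. vertex_cycle R xs \<and> set xs = {v. R\<^sup>*\<^sup>* u v}"
proof -
  have rsym: "R\<^sup>*\<^sup>* b a" if "R\<^sup>*\<^sup>* a b" for a b
    using that by (induction rule: rtranclp_induct) (auto dest: sym)
  then have conv: "R\<inverse>\<inverse>\<^sup>*\<^sup>* a b \<longleftrightarrow> R\<^sup>*\<^sup>* a b" for a b
    by (auto simp: rtranclp_conversep)
  from sym[OF \<open>R u w\<close>] \<open>R u w\<close> obtain w' where "R w' u"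
    by (metis rtranclp.cases)
  then have "\<exists>xs. vertex_cycle R\<inverse>\<inverse> xs \<and> set xs = {v. R\<inverse>\<inverse>\<^sup>*\<^sup>* u v}"
    by (intro hamiltonian_cycle_if_locally_in_semicomplete)
       (use fin out_local in \<open>auto simp: conv\<close>)
  then show ?thesis
    using vertex_cycle_rev[of R] by (metis conv set_rev Collect_cong)
qed

section \<open>From cycles of vertices to colored paths\<close>

context wf_digraph
begin

lemma awalk_if_successively_dominates:
  assumes "successively (dominates G) (u # xs)" "u \<in> verts G"
  shows "\<exists>p. awalk u p (last (u # xs)) \<and> awalk_verts u p = u # xs"
  using assms
proof (induction xs arbitrary: u)
  case Nil
  then show ?case
    by (intro exI[of _ "[]"]) (auto simp: awalk_Nil_iff)
next
  case (Cons x xs)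
  then obtain e where e: "e \<in> arcs G" "tail G e = u" "head G e = x"
    by auto
  moreover have "successively (dominates G) (x # xs)" "x \<in> verts G"
    using Cons.prems e by auto
  ultimately obtain p where "awalk x p (last (x # xs))" "awalk_verts x p = x # xs"
    using Cons.IH by blast
  with e show ?case
    by (intro exI[of _ "e # p"]) (auto simp: awalk_Cons_iff)
qed

lemma cycle_if_vertex_cycle:
  assumes "vertex_cycle (dominates G) xs" "u \<in> set xs"
  obtains p where "awalk u p u" "cycle p" "set (awalk_verts u p) = set xs"
proof -
  obtain ys where ys: "vertex_cycle (dominates G) (u # ys)" "set (u # ys) = set xs"
    using vertex_cycle_start_at[OF assms] .
  then have "u \<in> verts G" "successively (dominates G) (u # ys @ [u])"
    using adj_in_verts(2)[of "last (u # ys)" u]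
      successively_append_iff[of "dominates G" "u # ys" "[u]"]
    by (auto simp: vertex_cycle_def)
  from awalk_if_successively_dominates[OF this(2,1)]
  obtain p where p: "awalk u p u" "awalk_verts u p = u # ys @ [u]"
    by auto
  moreover have "p \<noteq> []"
    using p(2) by auto
  ultimately have "cycle p"
    using ys(1) by (auto simp: cycle_def vertex_cycle_def intro!: exI[of _ u])
  moreover have "set (awalk_verts u p) = set xs"
    using p(2) ys(2) by auto
  ultimately show thesis
    using that p(1) by blast
qed

lemma awalk_imp_rtranclp_dominates: "awalk u p v \<Longrightarrow> (dominates G)\<^sup>*\<^sup>* u v"
proof (induction p arbitrary: u)
  case (Cons e p)
  then have "u \<rightarrow> head G e" "(dominates G)\<^sup>*\<^sup>* (head G e) v"
    by (auto simp: awalk_Cons_iff in_arcs_imp_in_arcs_ends)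
  then show ?case
    by (rule converse_rtranclp_into_rtranclp)
qed (auto simp: awalk_Nil_iff)

lemma rtranclp_dominates_back_if_on_cycle:
  assumes "cycle p" "e \<in> set p"
  shows "(dominates G)\<^sup>*\<^sup>* (head G e) (tail G e)"
proof -
  obtain u where "awalk u p u"
    using assms(1) by (auto simp: cycle_def)
  moreover obtain q r where "p = q @ e # r"
    using split_list[OF assms(2)] by blast
  ultimately have "awalk u q (tail G e)" "awalk (head G e) r u"
    by (auto simp: awalk_Cons_iff)
  then show ?thesis
    by (blast dest: awalk_imp_rtranclp_dominates intro: rtranclp_trans)
qed

text \<open>
  A segment of a cycle uses only colors of the cycle, and it uses at least one because its ends
  differ.
\<close>

lemma few_colored_path_along_vertex_cycle:
  assumes cyc: "vertex_cycle (dominates G) xs" and uv: "u \<in> set xs" "v \<in> set xs" "u \<noteq> v"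
    and few: "\<And>p. cycle p \<Longrightarrow> num_colors c p \<le> k"
  shows "\<exists>j\<in>{1..k}. \<exists>p. colored_path G c j u p v"
proof -
  obtain p where p: "awalk u p u" "cycle p" "set (awalk_verts u p) = set xs"
    using cycle_if_vertex_cycle[OF cyc uv(1)] .
  with uv(2) obtain q r where q: "p = q @ r" "awalk u q v"
    using awalk_decomp[OF p(1), of v] by auto
  define s where "s = awalk_to_apath q"
  have s: "apath u s v"
    using q(2) unfolding s_def by (rule apath_awalk_to_apath)
  have "set s \<subseteq> set p"
    using awalk_to_apath_subset[OF q(2)] q(1) by (auto simp: s_def)
  then have "num_colors c s \<le> num_colors c p"
    unfolding num_colors_def by (intro card_mono) auto
  moreover have "s \<noteq> []"
    using s uv(3) by (auto simp: apath_Nil_iff)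
  then have "num_colors c s \<noteq> 0"
    by (simp add: num_colors_def)
  ultimately show ?thesis
    using s few[OF p(2)] by (intro bexI[of _ "num_colors c s"]) (auto simp: colored_path_def)
qed

end

lemma locally_in_tournament_adjacent:
  assumes "locally_in_tournament G" "a \<rightarrow>\<^bsub>G\<^esub> x" "b \<rightarrow>\<^bsub>G\<^esub> x" "a \<noteq> b"
  shows "a \<rightarrow>\<^bsub>G\<^esub> b \<or> b \<rightarrow>\<^bsub>G\<^esub> a"
proof -
  interpret digraph G
    using assms(1) by (simp add: locally_in_tournament_def)
  have "tournament (G \<restriction> in_neighbors G x)"
    using assms(1,2) by (auto simp: locally_in_tournament_def)
  then have "a \<rightarrow>\<^bsub>G \<restriction> in_neighbors G x\<^esub> b \<or> b \<rightarrow>\<^bsub>G \<restriction> in_neighbors G x\<^esub> a"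
    using assms(2-4) by (auto simp: tournament_def in_neighbors_def)
  then show ?thesis
    by (auto simp: arcs_ends_def arc_to_ends_def)
qed

lemma locally_out_tournament_adjacent:
  assumes "locally_out_tournament G" "x \<rightarrow>\<^bsub>G\<^esub> a" "x \<rightarrow>\<^bsub>G\<^esub> b" "a \<noteq> b"
  shows "a \<rightarrow>\<^bsub>G\<^esub> b \<or> b \<rightarrow>\<^bsub>G\<^esub> a"
proof -
  interpret digraph G
    using assms(1) by (simp add: locally_out_tournament_def)
  have "tournament (G \<restriction> out_neighbors G x)"
    using assms(1,2) by (auto simp: locally_out_tournament_def)
  then have "a \<rightarrow>\<^bsub>G \<restriction> out_neighbors G x\<^esub> b \<or> b \<rightarrow>\<^bsub>G \<restriction> out_neighbors G x\<^esub> a"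
    using assms(2-4) by (auto simp: tournament_def out_neighbors_def)
  then show ?thesis
    by (auto simp: arcs_ends_def arc_to_ends_def)
qed

section \<open>The kernel\<close>

theorem theorem20:
  fixes D :: "('a, 'b) pre_digraph" and c :: "'b \<Rightarrow> nat" and k m :: nat
  assumes "k \<ge> 1" and "m \<ge> 1"
    and "digraph D" and "verts D \<noteq> {}"
    and "m_colored m D c"
    and "locally_out_tournament D \<or> locally_in_tournament D"
    and "\<And>e. e \<in> arcs D \<Longrightarrow> \<exists>p. pre_digraph.cycle D p \<and> e \<in> set p"
    and "\<And>p. pre_digraph.cycle D p \<Longrightarrow> num_colors c p \<le> k"
  shows "\<exists>K. colored_kernel D c k K"
proof -
  interpret digraph D by fact
  let ?R = "dominates D"
  have sym: "?R\<^sup>*\<^sup>* b a" if "?R a b" for a b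
  proof -
    from that obtain e where "e \<in> arcs D" "tail D e = a" "head D e = b"
      by auto
    with assms(7) rtranclp_dominates_back_if_on_cycle show ?thesis
      by blast
  qed
  have rsym: "?R\<^sup>*\<^sup>* b a" if "?R\<^sup>*\<^sup>* a b" for a b
    using that by (induction rule: rtranclp_induct) (auto dest: sym)
  have component_verts: "v \<in> verts D" if "?R\<^sup>*\<^sup>* u v" "u \<in> verts D" for u v
    using that by (induction rule: rtranclp_induct) auto
  have hamiltonian: "\<exists>xs. vertex_cycle ?R xs \<and> set xs = {v. ?R\<^sup>*\<^sup>* u v}"
    if "?R u w" for u w
  proof -
    have "{v. ?R\<^sup>*\<^sup>* u v} \<subseteq> verts D"
      using that component_verts by auto
    then have fin: "finite {v. ?R\<^sup>*\<^sup>* u v}"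
      by (rule finite_subset) simp
    from assms(6) show ?thesis
    proof
      assume "locally_out_tournament D"
      from hamiltonian_cycle_if_locally_out_semicomplete[OF fin
          locally_out_tournament_adjacent[OF this] sym that]
      show ?thesis .
    next
      assume "locally_in_tournament D"
      from hamiltonian_cycle_if_locally_in_semicomplete[OF fin
          locally_in_tournament_adjacent[OF this] sym that]
      show ?thesis .
    qed
  qed
  have few_colored_path: "\<exists>j\<in>{1..k}. \<exists>p. colored_path D c j u p v"
    if "?R\<^sup>*\<^sup>* u v" "u \<noteq> v" for u v
  proof -
    from that obtain w where "?R u w"
      by (metis converse_rtranclpE)
    from hamiltonian[OF this]
    obtain xs where xs: "vertex_cycle ?R xs" "set xs = {v. ?R\<^sup>*\<^sup>* u v}"
      by blast
    show ?thesis
      by (rule few_colored_path_along_vertex_cycle[OF xs(1) _ _ that(2)])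
         (use xs(2) that(1) assms(8) in auto)
  qed
  \<comment> \<open>Vertices of one component have extensionally equal reachability predicates, so the choice
      operator picks the same representative for all of them.\<close>
  define rep where "rep u = (SOME v. ?R\<^sup>*\<^sup>* u v)" for u
  have to_rep: "?R\<^sup>*\<^sup>* u (rep u)" for u
    unfolding rep_def by (rule someI[of _ u]) simp
  have rep_eq: "rep u = rep v" if "?R\<^sup>*\<^sup>* u v" for u v
  proof -
    have "?R\<^sup>*\<^sup>* u = ?R\<^sup>*\<^sup>* v"
      using that rsym by (intro ext) (blast intro: rtranclp_trans)
    then show ?thesis
      by (simp add: rep_def)
  qed
  have "colored_absorbent D c k (rep ` verts D)"
    unfolding colored_absorbent_def
  proof
    fix u assume "u \<in> verts D - rep ` verts D"
    then have "rep u \<in> rep ` verts D" "u \<noteq> rep u"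
      by auto
    then show "\<exists>v\<in>rep ` verts D. \<exists>j\<in>{1..k}. \<exists>p. colored_path D c j u p v"
      using few_colored_path[OF to_rep] by blast
  qed
  moreover have "colored_independent D c k (rep ` verts D)"
  proof -
    have "rep u = rep v" if "colored_path D c j (rep u) p (rep v)" for j p u v
    proof -
      have "?R\<^sup>*\<^sup>* (rep u) (rep v)"
        using that by (auto simp: colored_path_def apath_def intro: awalk_imp_rtranclp_dominates)
      then have "?R\<^sup>*\<^sup>* u v"
        using to_rep rsym by (blast intro: rtranclp_trans)
      then show ?thesis
        by (rule rep_eq)
    qed
    then show ?thesis
      unfolding colored_independent_def by blast
  qed
  moreover have "rep ` verts D \<subseteq> verts D"
    using to_rep component_verts by blast
  ultimately have "colored_kernel D c k (rep ` verts D)"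
    using assms(4) by (simp add: colored_kernel_def)
  then show ?thesis ..
qed

end
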